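(* Let $d$ be a positive integer and $1 > \delta > 0$. Let $\mathcal{F}$ be a finite family of at least $2d$ convex sets in $\mathbb{R}^d$ such that the intersection of every $2d$ of them has diameter greater than or equal to one. Then $\mathcal{F}$ may be split into $c(2d,2d,d,\delta)$ parts such that the diameter of the intersection of each part is at least $1-\delta$, where $c(2d,2d,d,\delta)$ is the constant, depending only on $d$ and $\delta$, defined in the context.
   Context: The diameter $\operatorname{diam}(X)$ of a set $X\subset\mathbb{R}^d$ is the supremum of Euclidean distances between two of its points; the empty set does not have diameter at least any positive number. Parts of a splitting are allowed to be empty; the intersection of an empty family is $\mathbb{R}^d$. For positive integers $p\ge q\ge 2d$ and $1>\delta>0$, $c(p,q,d,\delta)$ denotes a positive integer depending only on $p,q,d,\delta$ with the following property (such an integer exists): for any finite family $\mathcal{G}$ of at least $p$ convex sets in $\mathbb{R}^d$ of diameter at least one each, if out of every $p$ sets in $\mathcal{G}$ there are $q$ of them whose intersection has diameter at least one, then there are $c(p,q,d,\delta)$ convex sets of diameter at least $1-\delta$ such that every set in $\mathcal{G}$ contains at least one of them. In particular $c(2d,2d,d,\delta)$ is this constant for $p=q=2d$. *)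

theory Defs
  imports "HOL-Analysis.Analysis"
begin

text \<open>
  The library's \<^const>\<open>diameter\<close> is real-valued and carries no information for unbounded sets,
  whereas the convex sets considered here need not be bounded, and the intersection of an empty
  part is the whole space. Hence a diameter with values in \<^typ>\<open>ennreal\<close>; the empty set gets 0.
\<close>

definition ediameter :: "'a::metric_space set \<Rightarrow> ennreal" where
  "ediameter S = (SUP x\<in>S. SUP y\<in>S. ennreal (dist x y))"

lemma ediameter_bounded:
  assumes "bounded S"
  shows "ediameter S = ennreal (diameter S)"
proof (cases "S = {}")
  case True
  then show ?thesis by (simp add: ediameter_def bot_ennreal)
next
  case False
  show ?thesis
  proof (rule antisym)
    show "ediameter S \<le> ennreal (diameter S)"
      unfolding ediameter_def
      by (intro SUP_least ennreal_leI diameter_bounded_bound assms)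
    show "ennreal (diameter S) \<le> ediameter S"
    proof (cases "ediameter S")
      case (real r)
      have "dist x y \<le> r" if "x \<in> S" "y \<in> S" for x y
      proof -
        have "ennreal (dist x y) \<le> ediameter S"
          unfolding ediameter_def by (intro SUP_upper2[OF that(1)] SUP_upper2[OF that(2)]) simp
        then show ?thesis using real by simp
      qed
      then have "diameter S \<le> r"
        using False unfolding diameter_def by (auto intro!: cSUP_least)
      then show ?thesis using real by (simp add: ennreal_leI)
    qed simp
  qed
qed

text \<open>
  The admissible values of the constant $c(p,q,d,\delta)$, where $d$ is the cardinality of the
  index type of the space. The constant is only determined by the property it has, so statements
  about it are statements about every \<open>c\<close> satisfying this predicate. The \<open>c\<close> sets \<open>K i\<close> may coincide.
\<close>

definition diameter_pq_constant ::
  "'n::finite itself \<Rightarrow> nat \<Rightarrow> nat \<Rightarrow> real \<Rightarrow> nat \<Rightarrow> bool" where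
  "diameter_pq_constant (T :: 'n itself) p q \<delta> c \<longleftrightarrow>
     0 < c \<and>
     (\<forall>G :: (real ^ 'n) set set.
        finite G \<and> p \<le> card G \<and>
        (\<forall>A\<in>G. convex A \<and> 1 \<le> ediameter A) \<and>
        (\<forall>H\<subseteq>G. card H = p \<longrightarrow> (\<exists>Q\<subseteq>H. card Q = q \<and> 1 \<le> ediameter (\<Inter>Q)))
        \<longrightarrow>
        (\<exists>K :: nat \<Rightarrow> (real ^ 'n) set.
           (\<forall>i<c. convex (K i) \<and> ennreal (1 - \<delta>) \<le> ediameter (K i)) \<and>
           (\<forall>A\<in>G. \<exists>i<c. K i \<subseteq> A)))"

end

theory Submission
  imports Defs
begin

text \<open>For p = q = 2d the (p,q) condition on F is the hypothesis itself, with
  \<open>Q = H\<close>. The defining property of \<open>c\<close> thus yields convex sets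
  \<open>K i\<close>, i < c, of diameter at least 1 - \<delta>, such that each member of F contains
  one of them. Grouping the members by such an index splits F: the intersection of part i contains
  \<open>K i\<close>, so \<open>ediameter_mono\<close> bounds its diameter from below.\<close>

lemma ediameter_mono:
  assumes "A \<subseteq> B"
  shows "ediameter A \<le> ediameter B"
  unfolding ediameter_def using assms by (intro SUP_subset_mono) auto

theorem corollary1p2:
  fixes \<delta> :: real and c :: nat and F :: "(real ^ 'n::finite) set set"
  assumes "0 < \<delta>" and "\<delta> < 1"
    and "diameter_pq_constant TYPE('n) (2 * CARD('n)) (2 * CARD('n)) \<delta> c"
    and "finite F" and "2 * CARD('n) \<le> card F"
    and "\<forall>A\<in>F. convex A"
    and "\<forall>H\<subseteq>F. card H = 2 * CARD('n) \<longrightarrow> 1 \<le> ediameter (\<Inter>H)"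
  shows "\<exists>P :: nat \<Rightarrow> (real ^ 'n) set set.
           disjoint_family_on P {..<c} \<and> (\<Union>i<c. P i) = F \<and>
           (\<forall>i<c. ennreal (1 - \<delta>) \<le> ediameter (\<Inter>(P i)))"
proof -
  let ?d = "2 * CARD('n)"
  \<comment> \<open>The property of \<open>c\<close> also asks that single members have diameter at
    least one. As F has at least 2d members, A lies in a subfamily of size 2d, whose intersection is
    contained in A.\<close>
  have member: "1 \<le> ediameter A" if "A \<in> F" for A
  proof -
    have "?d - 1 \<le> card (F - {A})"
      using assms(4,5) that by simp
    then obtain H where H: "H \<subseteq> F - {A}" "card H = ?d - 1" "finite H"
      by (rule obtain_subset_with_card_n)
    then have "card (insert A H) = ?d"
      by (subst card_insert_disjoint) auto
    with H that assms(7) have "1 \<le> ediameter (\<Inter>(insert A H))"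
      by blast
    also have "\<dots> \<le> ediameter A"
      by (intro ediameter_mono) auto
    finally show ?thesis .
  qed
  have "\<forall>A\<in>F. convex A \<and> 1 \<le> ediameter A"
    using assms(6) member by blast
  moreover have "\<forall>H\<subseteq>F. card H = ?d \<longrightarrow> (\<exists>Q\<subseteq>H. card Q = ?d \<and> 1 \<le> ediameter (\<Inter>Q))"
    using assms(7) by blast
  ultimately obtain K :: "nat \<Rightarrow> (real ^ 'n) set"
    where K: "\<forall>i<c. convex (K i) \<and> ennreal (1 - \<delta>) \<le> ediameter (K i)"
      and cover: "\<forall>A\<in>F. \<exists>i<c. K i \<subseteq> A"
    using assms(3)[unfolded diameter_pq_constant_def, THEN conjunct2, rule_format, of F] assms(4,5)
    by blast
  \<comment> \<open>A may contain several of the \<open>K i\<close>; fixing one index for each A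
    makes the fibres of \<open>g\<close> disjoint.\<close>
  from cover obtain g where g: "\<And>A. A \<in> F \<Longrightarrow> g A < c \<and> K (g A) \<subseteq> A"
    by metis
  define P where "P i = {A \<in> F. g A = i}" for i
  have "disjoint_family_on P {..<c}"
    by (auto simp: disjoint_family_on_def P_def)
  moreover have "(\<Union>i<c. P i) = F"
    using g by (auto simp: P_def)
  moreover have "ennreal (1 - \<delta>) \<le> ediameter (\<Inter>(P i))" if "i < c" for i
  proof -
    \<comment> \<open>This covers an empty part too: its intersection is the whole space, which
      contains \<open>K i\<close>.\<close>
    have "ediameter (K i) \<le> ediameter (\<Inter>(P i))"
      using g by (intro ediameter_mono) (auto simp: P_def)
    then show ?thesis
      using K that by (meson order_trans)
  qed
  ultimately show ?thesis
    by blast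
qed

end
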